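(* Let $A\in\mathbb{R}^{n\times d}$ and let $k$ be a positive integer. Then $$\sum_{i=1}^{d}\bar\tau_i(A)\le 2k.$$
   Context: $A$ has columns $a_1,\dots,a_d$. $A_k$ denotes a best rank-$k$ approximation of $A$ in Frobenius norm (obtained from a truncated SVD), so $\|A-A_k\|_F^2=\sum_{j>k}\sigma_j(A)^2$. $M^+$ denotes the Moore–Penrose pseudoinverse. The ($k$-)ridge leverage score of the $i$-th column of $A$ is $$\bar\tau_i(A)=a_i^T\Big(AA^T+\tfrac{\|A-A_k\|_F^2}{k}I_n\Big)^+a_i .$$ *)

theory Defs
  imports "HOL-Analysis.Analysis"
begin

text \<open>Squared Frobenius norm of a real matrix.\<close>
definition frob_sq :: "real^'d^'n \<Rightarrow> real" where
  "frob_sq M = (\<Sum>i\<in>UNIV. \<Sum>j\<in>UNIV. (M $ i $ j)^2)"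

text \<open>Squared Frobenius error of a best rank-k approximation A_k of A:
  the minimum of the squared Frobenius distance from A to matrices of rank at most k
  (equal to the sum of the squared singular values beyond the k-th).\<close>
definition best_rank_err :: "real^'d^'n \<Rightarrow> nat \<Rightarrow> real" where
  "best_rank_err A k = Inf {frob_sq (A - B) | B. rank B \<le> k}"

text \<open>Moore--Penrose pseudoinverse, as the unique matrix satisfying the Penrose equations.\<close>
definition pinv :: "real^'m^'n \<Rightarrow> real^'n^'m" where
  "pinv M = (THE X. M ** X ** M = M \<and> X ** M ** X = X \<and>
                    transpose (M ** X) = M ** X \<and> transpose (X ** M) = X ** M)"

text \<open>k-ridge leverage score of the i-th column of A.\<close>
definition ridge_lev :: "real^'d^'n \<Rightarrow> nat \<Rightarrow> 'd \<Rightarrow> real" where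
  "ridge_lev A k i =
     column i A \<bullet> (pinv (A ** transpose A + mat (best_rank_err A k / real k)) *v column i A)"

end

theory Submission
  imports Defs
begin

text \<open>Put \<open>\<lambda> = \<parallel>A - A\<^sub>k\<parallel>\<^sub>F\<^sup>2 / k\<close>, \<open>X = (AA\<^sup>T + \<lambda>I)\<^sup>+\<close> and \<open>u\<^sub>i = X a\<^sub>i\<close>. The Penrose equations for the
  symmetric matrix \<open>AA\<^sup>T + \<lambda>I\<close> give \<open>\<tau>\<^sub>i = |A\<^sup>Tu\<^sub>i|\<^sup>2 + \<lambda>|u\<^sub>i|\<^sup>2\<close>. For any \<open>B\<close> of rank at most \<open>k\<close>,
  the orthogonal projection \<open>P\<close> onto the row space of \<open>B\<close> splits \<open>a\<^sub>i = A y\<^sub>i + e\<^sub>i\<close>, where \<open>y\<^sub>i\<close> is the \<open>i\<close>-th column of \<open>P\<close>,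
  \<open>\<Sum> |y\<^sub>i|\<^sup>2 = tr P \<le> k\<close> and \<open>\<Sum> |e\<^sub>i|\<^sup>2 = \<parallel>A - AP\<parallel>\<^sub>F\<^sup>2 \<le> \<parallel>A - B\<parallel>\<^sub>F\<^sup>2\<close>. Then
  \<open>\<Sum> \<tau>\<^sub>i = \<Sum> \<langle>y\<^sub>i, A\<^sup>Tu\<^sub>i\<rangle> + \<Sum> \<langle>e\<^sub>i, u\<^sub>i\<rangle>\<close>, and AM-GM on both sums (the second one weighted by \<open>\<lambda>\<close>)
  yields \<open>\<lambda> (\<Sum> \<tau>\<^sub>i - k) \<le> \<parallel>A - B\<parallel>\<^sub>F\<^sup>2\<close>; minimising over \<open>B\<close> gives \<open>\<lambda> (\<Sum> \<tau>\<^sub>i - k) \<le> \<lambda> k\<close>.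
  If \<open>\<lambda> = 0\<close>, an arbitrarily small weight gives even \<open>\<Sum> \<tau>\<^sub>i \<le> k\<close>.\<close>

section \<open>Pseudoinverse of a symmetric matrix\<close>

lemma inner_matrix_vector: "(A *v x) \<bullet> y = x \<bullet> (transpose A *v y)"
  for A :: "real^'n^'m"
  by (metis dot_lmul_matrix inner_commute transpose_matrix_vector)

lemma symmetric_if_self_adjoint:
  fixes Y :: "real^'n^'n"
  assumes "\<And>y z. (Y *v y) \<bullet> z = y \<bullet> (Y *v z)"
  shows "transpose Y = Y"
proof -
  have "transpose Y *v z = Y *v z" for z
  proof -
    have "y \<bullet> (transpose Y *v z - Y *v z) = 0" for y
      using assms by (simp add: inner_diff_right inner_matrix_vector)
    then show ?thesis by (metis inner_eq_zero_iff right_minus_eq)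
  qed
  then show ?thesis by (simp add: matrix_eq)
qed

lemma span_range_matrix: "span (range ((*v) M)) = range ((*v) M)"
  for M :: "real^'m^'n"
  by (simp add: span_eq_iff linear_subspace_image matrix_vector_mul_linear)

definition penrose :: "real^'m^'n \<Rightarrow> real^'n^'m \<Rightarrow> bool" where
  "penrose M X \<longleftrightarrow> M ** X ** M = M \<and> X ** M ** X = X \<and>
     transpose (M ** X) = M ** X \<and> transpose (X ** M) = X ** M"

lemma penrose_unique:
  assumes "penrose M X" "penrose M Y"
  shows "X = Y"
proof -
  have X: "M ** X ** M = M" "X ** M ** X = X" "transpose (M ** X) = M ** X"
    "transpose (X ** M) = X ** M" and Y: "M ** Y ** M = M" "Y ** M ** Y = Y"
    "transpose (M ** Y) = M ** Y" "transpose (Y ** M) = Y ** M"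
    using assms by (auto simp: penrose_def)
  have "X = X ** transpose (M ** X)" using X(2,3) by (simp add: matrix_mul_assoc)
  also have "\<dots> = X ** transpose (M ** Y ** M ** X)" using Y(1) by simp
  also have "\<dots> = X ** transpose (M ** X) ** transpose (M ** Y)"
    by (simp add: matrix_transpose_mul matrix_mul_assoc)
  also have "\<dots> = X ** M ** Y" using X(2,3) Y(3) by (simp add: matrix_mul_assoc)
  finally have XMY: "X = X ** M ** Y" .
  have "Y = transpose (Y ** M) ** Y" using Y(2,4) by simp
  also have "\<dots> = transpose (Y ** (M ** X ** M)) ** Y" using X(1) by simp
  also have "\<dots> = transpose (X ** M) ** transpose (Y ** M) ** Y"
    by (simp add: matrix_transpose_mul matrix_mul_assoc)
  also have "\<dots> = X ** M ** Y" using X(4) Y(2,4) by (metis matrix_mul_assoc)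
  finally show ?thesis using XMY by simp
qed

lemma pinv_eqI: "penrose M X \<Longrightarrow> pinv M = X"
  unfolding pinv_def penrose_def[symmetric] using penrose_unique by blast

lemma penrose_transpose:
  assumes "transpose M = M" "penrose M X"
  shows "penrose M (transpose X)"
  using assms unfolding penrose_def
  by (metis matrix_transpose_mul matrix_mul_assoc transpose_transpose)

context
  fixes M :: "real^'n^'n"
  assumes symmetric: "transpose M = M"
begin

lemma symmetric_self_adjoint: "(M *v a) \<bullet> b = a \<bullet> (M *v b)"
  using inner_matrix_vector[of M a b] symmetric by simp

lemma null_if_orthogonal_range:
  assumes "\<And>v. v \<in> range ((*v) M) \<Longrightarrow> z \<bullet> v = 0"
  shows "M *v z = 0"
proof -
  have "(M *v z) \<bullet> (M *v z) = z \<bullet> (M *v (M *v z))" by (rule symmetric_self_adjoint)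
  then show ?thesis using assms by simp
qed

lemma eq_0_if_range_null:
  assumes "w \<in> range ((*v) M)" "M *v w = 0"
  shows "w = 0"
proof -
  obtain x where "w = M *v x" using assms(1) by blast
  then have "w \<bullet> w = x \<bullet> (M *v w)" by (simp add: symmetric_self_adjoint)
  then show ?thesis using assms(2) by simp
qed

text \<open>For symmetric \<open>M\<close>, the pseudoinverse sends \<open>y\<close> to the unique least-squares solution
  of \<open>M w = y\<close> that lies in the range of \<open>M\<close>.\<close>

definition least_squares :: "real^'n \<Rightarrow> real^'n \<Rightarrow> bool" where
  "least_squares y w \<longleftrightarrow>
     w \<in> range ((*v) M) \<and> (\<forall>v\<in>range ((*v) M). (y - M *v w) \<bullet> v = 0)"

lemma least_squares_exists: "\<exists>w. least_squares y w"
proof -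
  obtain p z where "p \<in> range ((*v) M)" and z: "\<And>v. v \<in> range ((*v) M) \<Longrightarrow> z \<bullet> v = 0"
    and "y = p + z"
    using orthogonal_subspace_decomp_exists[of "range ((*v) M)" y]
    unfolding span_range_matrix orthogonal_def by metis
  then obtain w0 where p: "p = M *v w0" by blast
  obtain w z' where w: "w \<in> range ((*v) M)" and "\<And>v. v \<in> range ((*v) M) \<Longrightarrow> z' \<bullet> v = 0"
    and "w0 = w + z'"
    using orthogonal_subspace_decomp_exists[of "range ((*v) M)" w0]
    unfolding span_range_matrix orthogonal_def by metis
  then have "M *v w = p"
    using null_if_orthogonal_range p by (simp add: matrix_vector_right_distrib)
  then have "least_squares y w"
    using w z \<open>y = p + z\<close> unfolding least_squares_def by auto
  then show ?thesis ..
qed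

lemma least_squares_unique:
  assumes "least_squares y w" "least_squares y w'"
  shows "w = w'"
proof -
  obtain a b where "w = M *v a" "w' = M *v b"
    using assms unfolding least_squares_def by blast
  then have "w - w' \<in> range ((*v) M)"
    by (metis matrix_vector_mult_diff_distrib rangeI)
  moreover have "(M *v (w - w')) \<bullet> v = 0" if "v \<in> range ((*v) M)" for v
  proof -
    have "M *v (w - w') = (y - M *v w') - (y - M *v w)"
      by (simp add: matrix_vector_mult_diff_distrib)
    moreover have "(y - M *v w) \<bullet> v = 0" "(y - M *v w') \<bullet> v = 0"
      using assms that unfolding least_squares_def by auto
    ultimately show ?thesis by (simp add: inner_diff_left)
  qed
  then have "M *v (w - w') = 0" by (metis inner_eq_zero_iff rangeI)
  ultimately show ?thesis using eq_0_if_range_null[of "w - w'"] by simp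
qed

definition min_norm_solution :: "real^'n \<Rightarrow> real^'n" where
  "min_norm_solution y = (THE w. least_squares y w)"

lemma least_squares_min_norm_solution: "least_squares y (min_norm_solution y)"
  unfolding min_norm_solution_def
  by (rule theI') (use least_squares_exists least_squares_unique in blast)

lemma min_norm_solution_in_range: "min_norm_solution y \<in> range ((*v) M)"
  using least_squares_min_norm_solution unfolding least_squares_def by blast

lemma min_norm_solution_residual_orthogonal:
  "v \<in> range ((*v) M) \<Longrightarrow> (y - M *v min_norm_solution y) \<bullet> v = 0"
  using least_squares_min_norm_solution unfolding least_squares_def by blast

lemma min_norm_solution_eqI: "least_squares y w \<Longrightarrow> min_norm_solution y = w"
  using least_squares_min_norm_solution least_squares_unique by blast

lemma linear_min_norm_solution: "linear min_norm_solution"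
proof (rule linearI)
  fix x y
  obtain a b where ab: "min_norm_solution x = M *v a" "min_norm_solution y = M *v b"
    using min_norm_solution_in_range by (metis rangeE)
  have "least_squares (x + y) (min_norm_solution x + min_norm_solution y)"
    unfolding least_squares_def
  proof
    show "min_norm_solution x + min_norm_solution y \<in> range ((*v) M)"
      using ab by (metis matrix_vector_right_distrib rangeI)
    show "\<forall>v\<in>range ((*v) M). (x + y - M *v (min_norm_solution x + min_norm_solution y)) \<bullet> v = 0"
      using min_norm_solution_residual_orthogonal[of _ x] min_norm_solution_residual_orthogonal[of _ y]
      by (simp add: matrix_vector_right_distrib inner_diff_left inner_add_left algebra_simps)
  qed
  then show "min_norm_solution (x + y) = min_norm_solution x + min_norm_solution y"
    by (rule min_norm_solution_eqI)
next
  fix c :: real and x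
  obtain a where a: "min_norm_solution x = M *v a"
    using min_norm_solution_in_range by (metis rangeE)
  have "least_squares (c *\<^sub>R x) (c *\<^sub>R min_norm_solution x)"
    unfolding least_squares_def
  proof
    show "c *\<^sub>R min_norm_solution x \<in> range ((*v) M)"
      using a by (metis matrix_vector_mult_scaleR rangeI)
    show "\<forall>v\<in>range ((*v) M). (c *\<^sub>R x - M *v (c *\<^sub>R min_norm_solution x)) \<bullet> v = 0"
      using min_norm_solution_residual_orthogonal[of _ x]
      by (simp add: matrix_vector_mult_scaleR inner_diff_left algebra_simps)
  qed
  then show "min_norm_solution (c *\<^sub>R x) = c *\<^sub>R min_norm_solution x"
    by (rule min_norm_solution_eqI)
qed

lemma M_min_norm_solution_M: "M *v min_norm_solution (M *v v) = M *v v"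
proof -
  let ?d = "M *v v - M *v min_norm_solution (M *v v)"
  have "?d \<in> range ((*v) M)" by (metis matrix_vector_mult_diff_distrib rangeI)
  then have "?d \<bullet> ?d = 0" by (rule min_norm_solution_residual_orthogonal)
  then show ?thesis by simp
qed

lemma min_norm_solution_M_min_norm_solution:
  "min_norm_solution (M *v min_norm_solution y) = min_norm_solution y"
  by (intro min_norm_solution_eqI) (simp add: least_squares_def min_norm_solution_in_range)

lemma min_norm_solution_self_adjoint:
  "min_norm_solution y \<bullet> z = y \<bullet> min_norm_solution z"
proof -
  have "min_norm_solution y \<bullet> (z - M *v min_norm_solution z) = 0"
    using min_norm_solution_residual_orthogonal[OF min_norm_solution_in_range]
    by (simp add: inner_commute)
  then have "min_norm_solution y \<bullet> z = min_norm_solution y \<bullet> (M *v min_norm_solution z)"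
    by (simp add: inner_diff_right)
  also have "\<dots> = (M *v min_norm_solution y) \<bullet> min_norm_solution z"
    by (simp add: symmetric_self_adjoint)
  also have "\<dots> = y \<bullet> min_norm_solution z"
    using min_norm_solution_residual_orthogonal[OF min_norm_solution_in_range, of y z]
    by (simp add: inner_diff_left)
  finally show ?thesis .
qed

lemma min_norm_solution_commute: "min_norm_solution (M *v z) = M *v min_norm_solution z"
proof (rule min_norm_solution_eqI)
  have "M *v (z - M *v min_norm_solution z) = 0"
    using min_norm_solution_residual_orthogonal by (rule null_if_orthogonal_range)
  then show "least_squares (M *v z) (M *v min_norm_solution z)"
    unfolding least_squares_def by (simp add: matrix_vector_mult_diff_distrib)
qed

lemma penrose_min_norm_solution: "penrose M (matrix min_norm_solution)"
proof -
  have X: "matrix min_norm_solution *v y = min_norm_solution y" for y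
    using linear_min_norm_solution by (simp add: matrix_works)
  show ?thesis
    unfolding penrose_def
  proof (intro conjI)
    show "M ** matrix min_norm_solution ** M = M"
      by (simp add: matrix_eq X M_min_norm_solution_M flip: matrix_vector_mul_assoc)
    show "matrix min_norm_solution ** M ** matrix min_norm_solution = matrix min_norm_solution"
      by (simp add: matrix_eq X min_norm_solution_M_min_norm_solution flip: matrix_vector_mul_assoc)
    show "transpose (M ** matrix min_norm_solution) = M ** matrix min_norm_solution"
      by (rule symmetric_if_self_adjoint)
        (simp add: X symmetric_self_adjoint min_norm_solution_self_adjoint min_norm_solution_commute
          flip: matrix_vector_mul_assoc)
    show "transpose (matrix min_norm_solution ** M) = matrix min_norm_solution ** M"
      by (rule symmetric_if_self_adjoint)
        (simp add: X symmetric_self_adjoint min_norm_solution_self_adjoint min_norm_solution_commute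
          flip: matrix_vector_mul_assoc)
  qed
qed

end

lemma penrose_pinv_symmetric:
  assumes "transpose M = M"
  shows "penrose M (pinv M)"
  using penrose_min_norm_solution[OF assms] pinv_eqI by metis

lemma transpose_pinv_symmetric:
  assumes "transpose M = M"
  shows "transpose (pinv M) = pinv M"
  using penrose_pinv_symmetric[OF assms] penrose_transpose[OF assms] penrose_unique by blast

section \<open>Orthogonal projection onto the row space of a low-rank matrix\<close>

context
  fixes W :: "'a::real_inner set"
  assumes finite_W: "finite W"
    and orthonormal_W: "\<And>v w. v \<in> W \<Longrightarrow> w \<in> W \<Longrightarrow> v \<bullet> w = (if v = w then 1 else 0)"
begin

definition orth_proj :: "'a \<Rightarrow> 'a" where
  "orth_proj q = (\<Sum>w\<in>W. (w \<bullet> q) *\<^sub>R w)"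

lemma inner_orth_proj: "v \<in> W \<Longrightarrow> v \<bullet> orth_proj q = v \<bullet> q"
  by (simp add: orth_proj_def inner_sum_right orthonormal_W if_distrib finite_W cong: if_cong)

lemma orth_proj_self_adjoint: "orth_proj q \<bullet> z = q \<bullet> orth_proj z"
  by (simp add: orth_proj_def inner_sum_left inner_sum_right inner_commute mult.commute)

lemma inner_orth_proj_orth_proj: "orth_proj q \<bullet> orth_proj z = (\<Sum>w\<in>W. (w \<bullet> q) * (w \<bullet> z))"
  unfolding orth_proj_def[of q] by (simp add: inner_sum_left inner_orth_proj)

lemma orth_proj_in_span: "orth_proj q \<in> span W"
  by (simp add: orth_proj_def span_sum span_mul span_base)

lemma orth_proj_residual_orthogonal: "b \<in> span W \<Longrightarrow> (q - orth_proj q) \<bullet> b = 0"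
proof (induction rule: span_induct)
  case base
  show ?case by (auto simp: subspace_def inner_add_right)
next
  case (step w)
  then show ?case by (simp add: inner_diff_left inner_diff_right inner_commute inner_orth_proj)
qed

lemma norm_orth_proj_residual_le:
  assumes "b \<in> span W"
  shows "norm (q - orth_proj q) \<le> norm (q - b)"
proof -
  have "orthogonal (q - orth_proj q) (orth_proj q - b)"
    using assms orth_proj_in_span unfolding orthogonal_def
    by (intro orth_proj_residual_orthogonal span_diff)
  then have "(norm (q - b))\<^sup>2 = (norm (q - orth_proj q))\<^sup>2 + (norm (orth_proj q - b))\<^sup>2"
    using norm_add_Pythagorean by fastforce
  then show ?thesis by (simp add: power2_le_imp_le)
qed

end

lemma sum_inner_orth_proj_axis:
  fixes W :: "(real^'d) set"
  assumes "finite W" and "\<And>v w. v \<in> W \<Longrightarrow> w \<in> W \<Longrightarrow> v \<bullet> w = (if v = w then 1 else 0)"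
  shows "(\<Sum>i\<in>UNIV. orth_proj W (axis i 1) \<bullet> orth_proj W (axis i 1)) = real (card W)"
proof -
  have "(\<Sum>i\<in>UNIV. orth_proj W (axis i 1) \<bullet> orth_proj W (axis i 1))
      = (\<Sum>i\<in>UNIV. \<Sum>w\<in>W. (w $ i) * (w $ i))"
    by (simp add: inner_orth_proj_orth_proj[OF assms] inner_axis)
  also have "\<dots> = (\<Sum>w\<in>W. w \<bullet> w)"
    by (subst sum.swap) (simp add: inner_vec_def)
  also have "\<dots> = real (card W)" using assms(2) by simp
  finally show ?thesis .
qed

lemma frob_sq_rows: "frob_sq M = (\<Sum>j\<in>UNIV. M $ j \<bullet> M $ j)"
  by (simp add: frob_sq_def inner_vec_def power2_eq_square)

lemma low_rank_column_decomposition: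
  fixes A B :: "real^'d^'n"
  assumes "rank B \<le> k"
  obtains y :: "'d \<Rightarrow> real^'d" and e :: "'d \<Rightarrow> real^'n"
  where "\<And>i. column i A = A *v y i + e i"
    and "(\<Sum>i\<in>UNIV. y i \<bullet> y i) \<le> real k"
    and "(\<Sum>i\<in>UNIV. e i \<bullet> e i) \<le> frob_sq (A - B)"
proof -
  obtain W where "pairwise orthogonal W" and "\<And>w. w \<in> W \<Longrightarrow> norm w = 1"
    and "independent W" and card_W: "card W = dim (span (rows B))" and span_W: "span W = span (rows B)"
    using orthonormal_basis_subspace[OF subspace_span] by metis
  then have fin: "finite W" and orthonormal: "\<And>v w. v \<in> W \<Longrightarrow> w \<in> W \<Longrightarrow> v \<bullet> w = (if v = w then 1 else 0)"
    by (auto simp: independent_imp_finite pairwise_def orthogonal_def norm_eq_1)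
  define P where "P = orth_proj W"
  note P_self_adjoint = orth_proj_self_adjoint[OF fin orthonormal, folded P_def]
    and norm_P_residual_le = norm_orth_proj_residual_le[OF fin orthonormal, folded P_def]
  define y where "y i = P (axis i 1)" for i
  define e where "e i = column i A - A *v y i" for i
  have y_bound: "(\<Sum>i\<in>UNIV. y i \<bullet> y i) \<le> real k"
    using sum_inner_orth_proj_axis[OF fin orthonormal] card_W assms
    by (simp add: y_def P_def row_rank_def)
  have e_component: "e i $ j = (A $ j - P (A $ j)) $ i" for i j
  proof -
    have "(A *v y i) $ j = P (A $ j) \<bullet> axis i 1"
      by (simp add: y_def matrix_vector_mul_component P_self_adjoint)
    then show ?thesis by (simp add: e_def column_def inner_axis)
  qed
  have "(\<Sum>i\<in>UNIV. e i \<bullet> e i) = (\<Sum>j\<in>UNIV. (A $ j - P (A $ j)) \<bullet> (A $ j - P (A $ j)))"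
    by (simp add: inner_vec_def e_component) (rule sum.swap)
  also have "\<dots> \<le> (\<Sum>j\<in>UNIV. (A - B) $ j \<bullet> (A - B) $ j)"
  proof (rule sum_mono)
    fix j
    have "B $ j \<in> span W" using span_W by (auto simp: rows_def row_def intro: span_base)
    then have "norm (A $ j - P (A $ j)) \<le> norm ((A - B) $ j)" by (simp add: norm_P_residual_le)
    then show "(A $ j - P (A $ j)) \<bullet> (A $ j - P (A $ j)) \<le> (A - B) $ j \<bullet> (A - B) $ j"
      by (simp add: power2_norm_eq_inner[symmetric] power_mono)
  qed
  also have "\<dots> = frob_sq (A - B)" by (simp add: frob_sq_rows)
  finally show ?thesis using that[of y e] y_bound by (simp add: e_def)
qed

section \<open>Ridge leverage scores\<close>

lemma two_mult_inner_le: "2 * t * (x \<bullet> y) \<le> x \<bullet> x + t\<^sup>2 * (y \<bullet> y)"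
  for x y :: "'a::real_inner"
proof -
  have "0 \<le> (x - t *\<^sub>R y) \<bullet> (x - t *\<^sub>R y)" by simp
  then show ?thesis by (simp add: inner_diff_left inner_diff_right inner_commute power2_eq_square)
qed

lemma pinv_quadratic_form:
  assumes "transpose M = M"
  shows "q \<bullet> (pinv M *v q) = (pinv M *v q) \<bullet> (M *v (pinv M *v q))"
proof -
  have "pinv M ** M ** pinv M = pinv M"
    using penrose_pinv_symmetric[OF assms] by (simp add: penrose_def)
  then show ?thesis
    using transpose_pinv_symmetric[OF assms]
    by (simp add: inner_matrix_vector matrix_vector_mul_assoc matrix_mul_assoc)
qed

lemma mat_vector_mult: "mat c *v x = c *\<^sub>R x"
  for x :: "real^'n"
  by (simp add: vec_eq_iff matrix_vector_mult_def mat_def if_distrib if_distribR cong: if_cong)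

lemma transpose_ridge_matrix: "transpose (A ** transpose A + mat c) = A ** transpose A + mat c"
  for A :: "real^'d^'n"
  by (simp add: vec_eq_iff transpose_def matrix_matrix_mult_def mat_def mult.commute)

lemma sum_ridge_scores_le:
  fixes A :: "real^'d^'n" and lam t :: real
  assumes "t \<ge> 0" and decomposition: "\<And>i. column i A = A *v y i + e i"
  defines "X \<equiv> pinv (A ** transpose A + mat lam)"
  shows "t * ((\<Sum>i\<in>UNIV. column i A \<bullet> (X *v column i A)) - (\<Sum>i\<in>UNIV. y i \<bullet> y i))
    \<le> (\<Sum>i\<in>UNIV. e i \<bullet> e i) + t * (t - lam) * (\<Sum>i\<in>UNIV. (X *v column i A) \<bullet> (X *v column i A))"
proof -
  define u where "u i = X *v column i A" for i
  define v where "v i = transpose A *v u i" for i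
  have "column i A \<bullet> u i = u i \<bullet> ((A ** transpose A + mat lam) *v u i)" for i
    unfolding u_def X_def by (rule pinv_quadratic_form[OF transpose_ridge_matrix])
  then have score_eq: "column i A \<bullet> u i = v i \<bullet> v i + lam * (u i \<bullet> u i)" for i
    by (simp add: v_def matrix_vector_mult_add_rdistrib mat_vector_mult inner_add_right
        flip: matrix_vector_mul_assoc dot_lmul_matrix)
  have score_split: "column i A \<bullet> u i = y i \<bullet> v i + e i \<bullet> u i" for i
    by (subst decomposition) (simp add: v_def inner_add_left inner_matrix_vector)
  define S Y V E U where "S = (\<Sum>i\<in>UNIV. column i A \<bullet> u i)" and "Y = (\<Sum>i\<in>UNIV. y i \<bullet> y i)"
    and "V = (\<Sum>i\<in>UNIV. v i \<bullet> v i)" and "E = (\<Sum>i\<in>UNIV. e i \<bullet> e i)"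
    and "U = (\<Sum>i\<in>UNIV. u i \<bullet> u i)"
  have S_eq: "S = V + lam * U"
    by (simp add: S_def V_def U_def score_eq sum.distrib sum_distrib_left)
  have S_split: "S = (\<Sum>i\<in>UNIV. y i \<bullet> v i) + (\<Sum>i\<in>UNIV. e i \<bullet> u i)"
    by (simp add: S_def score_split sum.distrib)
  have "(\<Sum>i\<in>UNIV. 2 * (y i \<bullet> v i)) \<le> (\<Sum>i\<in>UNIV. y i \<bullet> y i + v i \<bullet> v i)"
    using two_mult_inner_le[of 1] by (intro sum_mono) simp
  then have "2 * (\<Sum>i\<in>UNIV. y i \<bullet> v i) \<le> Y + V"
    by (simp add: Y_def V_def sum_distrib_left sum.distrib)
  then have yv: "t * (2 * (\<Sum>i\<in>UNIV. y i \<bullet> v i)) \<le> t * (Y + V)"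
    using \<open>t \<ge> 0\<close> by (rule mult_left_mono)
  have "(\<Sum>i\<in>UNIV. 2 * t * (e i \<bullet> u i)) \<le> (\<Sum>i\<in>UNIV. e i \<bullet> e i + t\<^sup>2 * (u i \<bullet> u i))"
    by (intro sum_mono two_mult_inner_le)
  then have eu: "2 * t * (\<Sum>i\<in>UNIV. e i \<bullet> u i) \<le> E + t\<^sup>2 * U"
    by (simp add: E_def U_def sum_distrib_left sum.distrib)
  have "t * S = t * V + t * lam * U" using S_eq by (simp add: algebra_simps)
  moreover have "t * S = t * (\<Sum>i\<in>UNIV. y i \<bullet> v i) + t * (\<Sum>i\<in>UNIV. e i \<bullet> u i)"
    using S_split by (simp add: algebra_simps)
  ultimately have "t * (S - Y) \<le> E + t * (t - lam) * U"
    using yv eu by (simp add: algebra_simps power2_eq_square)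
  then show ?thesis by (simp add: S_def Y_def E_def U_def u_def)
qed

lemma best_rank_err_nonneg: "0 \<le> best_rank_err A k"
  unfolding best_rank_err_def frob_sq_def
  by (rule cInf_greatest) (auto intro!: exI[of _ 0] sum_nonneg)

lemma le_best_rank_err:
  assumes "\<And>B. rank B \<le> k \<Longrightarrow> c \<le> frob_sq (A - B)"
  shows "c \<le> best_rank_err A k"
  unfolding best_rank_err_def using assms
  by (intro cInf_greatest) (auto intro!: exI[of _ 0])

lemma sum_ridge_scores_le_best_rank_err:
  fixes A :: "real^'d^'n" and lam t :: real
  assumes "t \<ge> 0"
  defines "X \<equiv> pinv (A ** transpose A + mat lam)"
  shows "t * ((\<Sum>i\<in>UNIV. column i A \<bullet> (X *v column i A)) - real k)
    \<le> best_rank_err A k + t * (t - lam) * (\<Sum>i\<in>UNIV. (X *v column i A) \<bullet> (X *v column i A))"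
    (is "t * (?S - _) \<le> _ + ?R")
proof -
  have "t * (?S - real k) - ?R \<le> frob_sq (A - B)" if rank_B: "rank B \<le> k" for B
  proof -
    obtain y e where decomposition: "\<And>i. column i A = A *v y i + e i"
      and y: "(\<Sum>i\<in>UNIV. y i \<bullet> y i) \<le> real k" and e: "(\<Sum>i\<in>UNIV. e i \<bullet> e i) \<le> frob_sq (A - B)"
      using low_rank_column_decomposition[OF rank_B, of A] by blast
    have "t * (?S - real k) \<le> t * (?S - (\<Sum>i\<in>UNIV. y i \<bullet> y i))"
      using y assms(1) by (intro mult_left_mono) auto
    also have "\<dots> \<le> (\<Sum>i\<in>UNIV. e i \<bullet> e i) + ?R"
      unfolding X_def by (rule sum_ridge_scores_le[OF assms(1) decomposition])
    finally show ?thesis using e by linarith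
  qed
  then show ?thesis using le_best_rank_err[of k _ A] by force
qed

lemma nonpos_if_le_all_multiples:
  fixes x U :: real
  assumes "U \<ge> 0" and "\<And>t. t > 0 \<Longrightarrow> x \<le> t * U"
  shows "x \<le> 0"
proof (rule field_le_epsilon)
  fix \<epsilon> :: real
  assume "\<epsilon> > 0"
  then have "\<epsilon> / (U + 1) > 0" and "\<epsilon> / (U + 1) * U \<le> \<epsilon>"
    using assms(1) by (simp_all add: field_simps)
  then show "x \<le> 0 + \<epsilon>" using assms(2) by fastforce
qed

theorem mainTheorem1:
  fixes A :: "real^'d^'n" and k :: nat
  assumes "k > 0"
  shows "(\<Sum>i\<in>UNIV. ridge_lev A k i) \<le> 2 * real k"
proof -
  define lam where "lam = best_rank_err A k / real k"
  define X where "X = pinv (A ** transpose A + mat lam)"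
  define S where "S = (\<Sum>i\<in>UNIV. column i A \<bullet> (X *v column i A))"
  define U where "U = (\<Sum>i\<in>UNIV. (X *v column i A) \<bullet> (X *v column i A))"
  have err: "best_rank_err A k = lam * real k" and "lam \<ge> 0"
    using assms best_rank_err_nonneg[of A k] by (simp_all add: lam_def)
  have bound: "t * (S - real k) \<le> lam * real k + t * (t - lam) * U" if "t \<ge> 0" for t
    using sum_ridge_scores_le_best_rank_err[OF that, of A lam k] by (simp add: err S_def U_def X_def)
  have "S \<le> 2 * real k"
  proof (cases "lam = 0")
    case True
    have "S - real k \<le> t * U" if "t > 0" for t
    proof -
      have "t * (S - real k) \<le> t * (t * U)" using bound[of t] that True by (simp add: algebra_simps)
      then show ?thesis using that by simp
    qed
    moreover have "U \<ge> 0" unfolding U_def by (intro sum_nonneg) simp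
    ultimately have "S - real k \<le> 0" using nonpos_if_le_all_multiples by blast
    then show ?thesis by simp
  next
    case False
    then show ?thesis using bound[of lam] \<open>lam \<ge> 0\<close> by simp
  qed
  then show ?thesis by (simp add: S_def X_def lam_def ridge_lev_def)
qed

end
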